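(* Let $n=n_d\ge1$, $\alpha=\alpha_d>0$, $1\le s=s_d\le d$ and $a=a_d$ depend on $d$, and set $C_1=2\Phi(2\sqrt c)-1>0$, where $\Phi$ is the standard normal cumulative distribution function. Assume that, as $d\to\infty$, $$\frac{\alpha}{d}\to0,\qquad \frac{n\alpha^2}{d^2}\to+\infty,\qquad \limsup\frac{\log(d/s)}{n\alpha^2/d^2}<\frac{C_1^2}{2^9}.$$ Let $\tau=C_1/2$, $\hat\eta^+_j=I\bigl(\frac1n\sum_{i=1}^nZ^i_j\ge\tau\bigr)$ and $\hat\eta_j=I\bigl(\bigl|\frac1n\sum_{i=1}^nZ^i_j\bigr|\ge\tau\bigr)$, $j=1,\dots,d$. Then for all $a\ge2\sigma$, as $d\to\infty$, $$\sup_{\theta\in\Theta_d^+(s,a)}\frac1s\mathbb{E}|\hat\eta^+-\eta|\to0\qquad\text{and}\qquad \sup_{\theta\in\Theta_d(s,a)}\frac1s\mathbb{E}|\hat\eta-\eta|\to0 .$$ If, in addition, $\limsup\frac{\log(d)}{n\alpha^2/d^2}<\frac{C_1^2}{2^9}$, then for all $a\ge2\sigma$, $$\sup_{\theta\in\Theta_d^+(s,a)}\mathbb{E}|\hat\eta^+-\eta|\to0\qquad\text{and}\qquad \sup_{\theta\in\Theta_d(s,a)}\mathbb{E}|\hat\eta-\eta|\to0 .$$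
   Context: Model: $\sigma>0$, $\theta\in\mathbb{R}^d$; $X^1,\dots,X^n$ are i.i.d. random vectors in $\mathbb{R}^d$, $X^i=\theta+\sigma\xi^i$, where $\xi^i$ has i.i.d. coordinates whose common law on $\mathbb{R}$ (not depending on $d$) is symmetric around $0$, has variance $1$ and is $c$-strongly log-concave for a constant $c>0$: it has density $p(x)=\exp(-\phi_0(x))\exp(-cx^2/2)$ with $\phi_0:\mathbb{R}\to\mathbb{R}$ a finite even convex function. $\Theta_d^+(s,a)$ (resp. $\Theta_d(s,a)$) is the set of $\theta\in\mathbb{R}^d$ for which there is $S\subseteq\{1,\dots,d\}$ with at most $s$ elements such that $\theta_j\ge a$ (resp. $|\theta_j|\ge a$) for $j\in S$ and $\theta_j=0$ for $j\notin S$. Put $\eta=(I(\theta_j\ne0))_{j=1,\dots,d}$ and $|\hat\eta-\eta|=\sum_{j=1}^d I(\hat\eta_j\neq\eta_j)$. Privatized data (Laplace mechanism): $Z^i_j=\mathrm{sgn}[X^i_j]+\frac{2d}{\alpha}W^i_j$, $i=1,\dots,n$, $j=1,\dots,d$, where $\mathrm{sgn}[x]=1$ for $x\ge0$ and $\mathrm{sgn}[x]=-1$ for $x<0$, and the $W^i_j$ are i.i.d. Laplace$(1)$ variables (density $\frac12e^{-|x|}$), independent of the $X^i$. Expectations are over the joint law of the $X^i$ and $W^i_j$. *)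

theory Defs
  imports "HOL-Probability.Probability"
begin

text \<open>Vectors in dimension \<open>d\<close> are extensional functions on \<open>{1..d}\<close>, since \<open>d\<close> tends to infinity
  inside the statement.\<close>

text \<open>The law on the real line of one coordinate of the noise \<open>\<xi>\<close>. Since \<open>variance\<close> is a Bochner
  integral (0 if divergent), variance 1 entails a finite second moment.\<close>

definition noise_law :: "real \<Rightarrow> real measure \<Rightarrow> bool" where
  "noise_law c \<nu> \<longleftrightarrow>
     prob_space \<nu> \<and>
     distr \<nu> borel uminus = \<nu> \<and>
     prob_space.variance \<nu> (\<lambda>x. x) = 1 \<and>
     (\<exists>\<phi> :: real \<Rightarrow> real. convex_on UNIV \<phi> \<and> (\<forall>x. \<phi> (- x) = \<phi> x) \<and>
        \<nu> = density lborel (\<lambda>x. ennreal (exp (- \<phi> x) * exp (- (c * x\<^sup>2 / 2)))))"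

definition laplace_density :: "real \<Rightarrow> real" where
  "laplace_density x = exp (- \<bar>x\<bar>) / 2"

text \<open>All the \<open>\<xi> i j\<close> and \<open>W i j\<close> together form one independent family; the disjoint sum
  merges the two index sets.\<close>

definition sampling_model ::
  "'w measure \<Rightarrow> real measure \<Rightarrow> nat \<Rightarrow> nat \<Rightarrow>
   (nat \<Rightarrow> nat \<Rightarrow> 'w \<Rightarrow> real) \<Rightarrow> (nat \<Rightarrow> nat \<Rightarrow> 'w \<Rightarrow> real) \<Rightarrow> bool" where
  "sampling_model M \<nu> n d \<xi> W \<longleftrightarrow>
     prob_space M \<and>
     (\<forall>i\<in>{1..n}. \<forall>j\<in>{1..d}. \<xi> i j \<in> borel_measurable M \<and> distr M borel (\<xi> i j) = \<nu>) \<and>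
     (\<forall>i\<in>{1..n}. \<forall>j\<in>{1..d}. distributed M lborel (W i j) (\<lambda>x. ennreal (laplace_density x))) \<and>
     prob_space.indep_vars M (\<lambda>_. borel)
       (case_sum (\<lambda>(i, j). \<xi> i j) (\<lambda>(i, j). W i j))
       (({1..n} \<times> {1..d}) <+> ({1..n} \<times> {1..d}))"

definition observation ::
  "(nat \<Rightarrow> real) \<Rightarrow> real \<Rightarrow> (nat \<Rightarrow> nat \<Rightarrow> 'w \<Rightarrow> real) \<Rightarrow> nat \<Rightarrow> nat \<Rightarrow> 'w \<Rightarrow> real" where
  "observation \<theta> \<sigma> \<xi> i j \<omega> = \<theta> j + \<sigma> * \<xi> i j \<omega>"

text \<open>Unlike the library's \<open>sgn\<close>, this sign function takes the value 1 at 0.\<close>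

definition sign1 :: "real \<Rightarrow> real" where
  "sign1 x = (if x \<ge> 0 then 1 else - 1)"

definition privatize ::
  "nat \<Rightarrow> real \<Rightarrow> (nat \<Rightarrow> nat \<Rightarrow> 'w \<Rightarrow> real) \<Rightarrow> (nat \<Rightarrow> nat \<Rightarrow> 'w \<Rightarrow> real) \<Rightarrow> nat \<Rightarrow> nat \<Rightarrow> 'w \<Rightarrow> real" where
  "privatize d \<alpha> X W i j \<omega> = sign1 (X i j \<omega>) + 2 * real d / \<alpha> * W i j \<omega>"

definition sample_mean :: "nat \<Rightarrow> (nat \<Rightarrow> nat \<Rightarrow> 'w \<Rightarrow> real) \<Rightarrow> nat \<Rightarrow> 'w \<Rightarrow> real" where
  "sample_mean n Z j \<omega> = 1 / real n * (\<Sum>i = 1..n. Z i j \<omega>)"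

definition C1 :: "real \<Rightarrow> real" where
  "C1 c = 2 * cdf std_normal_distribution (2 * sqrt c) - 1"

definition eta :: "(nat \<Rightarrow> real) \<Rightarrow> nat \<Rightarrow> nat" where
  "eta \<theta> j = of_bool (\<theta> j \<noteq> 0)"

definition eta_hat_plus ::
  "real \<Rightarrow> nat \<Rightarrow> (nat \<Rightarrow> nat \<Rightarrow> 'w \<Rightarrow> real) \<Rightarrow> 'w \<Rightarrow> nat \<Rightarrow> nat" where
  "eta_hat_plus \<tau> n Z \<omega> j = of_bool (sample_mean n Z j \<omega> \<ge> \<tau>)"

definition eta_hat ::
  "real \<Rightarrow> nat \<Rightarrow> (nat \<Rightarrow> nat \<Rightarrow> 'w \<Rightarrow> real) \<Rightarrow> 'w \<Rightarrow> nat \<Rightarrow> nat" where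
  "eta_hat \<tau> n Z \<omega> j = of_bool (\<bar>sample_mean n Z j \<omega>\<bar> \<ge> \<tau>)"

definition hamming_loss :: "nat \<Rightarrow> (nat \<Rightarrow> nat) \<Rightarrow> (nat \<Rightarrow> nat) \<Rightarrow> real" where
  "hamming_loss d u v = (\<Sum>j = 1..d. of_bool (u j \<noteq> v j))"

definition Theta_plus :: "nat \<Rightarrow> nat \<Rightarrow> real \<Rightarrow> (nat \<Rightarrow> real) set" where
  "Theta_plus d s a = {\<theta> \<in> {1..d} \<rightarrow>\<^sub>E UNIV.
     \<exists>S \<subseteq> {1..d}. card S \<le> s \<and> (\<forall>j\<in>S. \<theta> j \<ge> a) \<and> (\<forall>j\<in>{1..d} - S. \<theta> j = 0)}"

definition Theta :: "nat \<Rightarrow> nat \<Rightarrow> real \<Rightarrow> (nat \<Rightarrow> real) set" where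
  "Theta d s a = {\<theta> \<in> {1..d} \<rightarrow>\<^sub>E UNIV.
     \<exists>S \<subseteq> {1..d}. card S \<le> s \<and> (\<forall>j\<in>S. \<bar>\<theta> j\<bar> \<ge> a) \<and> (\<forall>j\<in>{1..d} - S. \<theta> j = 0)}"

text \<open>Expected Hamming losses with threshold \<open>C1 c / 2\<close>. They lie in \<open>[0, d]\<close>, and \<open>Theta_plus\<close>
  and \<open>Theta\<close> contain the zero vector, so real-valued suprema of these risks are meaningful.\<close>

definition risk_plus ::
  "'w measure \<Rightarrow> real \<Rightarrow> real \<Rightarrow> nat \<Rightarrow> nat \<Rightarrow> real \<Rightarrow>
   (nat \<Rightarrow> nat \<Rightarrow> 'w \<Rightarrow> real) \<Rightarrow> (nat \<Rightarrow> nat \<Rightarrow> 'w \<Rightarrow> real) \<Rightarrow> (nat \<Rightarrow> real) \<Rightarrow> real" where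
  "risk_plus M c \<sigma> n d \<alpha> \<xi> W \<theta> =
     (let Z = privatize d \<alpha> (observation \<theta> \<sigma> \<xi>) W
      in prob_space.expectation M (\<lambda>\<omega>. hamming_loss d (eta_hat_plus (C1 c / 2) n Z \<omega>) (eta \<theta>)))"

definition risk ::
  "'w measure \<Rightarrow> real \<Rightarrow> real \<Rightarrow> nat \<Rightarrow> nat \<Rightarrow> real \<Rightarrow>
   (nat \<Rightarrow> nat \<Rightarrow> 'w \<Rightarrow> real) \<Rightarrow> (nat \<Rightarrow> nat \<Rightarrow> 'w \<Rightarrow> real) \<Rightarrow> (nat \<Rightarrow> real) \<Rightarrow> real" where
  "risk M c \<sigma> n d \<alpha> \<xi> W \<theta> =
     (let Z = privatize d \<alpha> (observation \<theta> \<sigma> \<xi>) W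
      in prob_space.expectation M (\<lambda>\<omega>. hamming_loss d (eta_hat (C1 c / 2) n Z \<omega>) (eta \<theta>)))"

end

theory Submission
  imports Defs
begin

text \<open>The mean of \<open>sgn[X\<^sub>j]\<close> is 0 if \<open>\<theta>\<^sub>j = 0\<close> and at least \<open>C\<^sub>1\<close> in absolute value if
  \<open>\<bar>\<theta>\<^sub>j\<bar> \<ge> 2\<sigma>\<close>, because a symmetric \<open>c\<close>-strongly log-concave law is more concentrated
  around 0 than \<open>N(0, 1/c)\<close>. Hence coordinate \<open>j\<close> is misclassified only if the sample mean of the
  \<open>Z\<^sub>j\<close> deviates from its expectation by at least \<open>C\<^sub>1/2\<close>. With \<open>T = n\<alpha>\<^sup>2/d\<^sup>2\<close>, Chernoff's
  bound, Hoeffding's lemma for the signs and the Laplace moment generating function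
  \<open>1/(1 - u\<^sup>2) \<le> exp (2u\<^sup>2)\<close> bound the probability of this by \<open>2 exp (- C\<^sub>1\<^sup>2 T/2\<^sup>8)\<close> as
  soon as \<open>\<alpha> \<le> d\<close>. Since eventually \<open>d/s \<le> exp (C\<^sub>1\<^sup>2 T/2\<^sup>9)\<close>, the sum over all \<open>d\<close>
  coordinates divided by \<open>s\<close> is at most \<open>2 exp (- C\<^sub>1\<^sup>2 T/2\<^sup>9)\<close>; the unnormalized case is
  the same estimate with 1 in place of \<open>s\<close>.\<close>

section \<open>Comparison and symmetry of laws on the real line\<close>

text \<open>Both inequalities arise when the density ratio is at least k on A and at most k off A.
  Multiplying each by the \<open>\<gamma>\<close>-mass of the other set eliminates k, so no
  normalizing constant has to be computed.\<close>

lemma prob_ge_of_density_ratio: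
  assumes "prob_space \<nu>" "prob_space \<gamma>" and sets: "sets \<nu> = sets \<gamma>" and A: "A \<in> sets \<gamma>"
    and inside: "k * measure \<gamma> A \<le> measure \<nu> A"
    and outside: "measure \<nu> (space \<nu> - A) \<le> k * measure \<gamma> (space \<gamma> - A)"
  shows "measure \<gamma> A \<le> measure \<nu> A"
proof -
  interpret N: prob_space \<nu> by fact
  interpret G: prob_space \<gamma> by fact
  have "1 - measure \<nu> A \<le> k * (1 - measure \<gamma> A)"
    using outside A sets by (simp add: N.prob_compl G.prob_compl)
  then have "(1 - measure \<nu> A) * measure \<gamma> A \<le> k * (1 - measure \<gamma> A) * measure \<gamma> A"
    by (rule mult_right_mono) simp
  also have "\<dots> = k * measure \<gamma> A * (1 - measure \<gamma> A)"
    by simp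
  also have "\<dots> \<le> measure \<nu> A * (1 - measure \<gamma> A)"
    using inside by (rule mult_right_mono) simp
  finally show ?thesis
    by (simp add: algebra_simps)
qed

text \<open>Reflection turns \<open>{.. - x}\<close> into \<open>{x..}\<close>, which differs from
  the complement of \<open>{..x}\<close> only by the null set \<open>{x}\<close>.\<close>

lemma cdf_uminus_symmetric:
  assumes "real_distribution \<nu>" and sym: "distr \<nu> borel uminus = \<nu>" and "measure \<nu> {x} = 0"
  shows "cdf \<nu> (- x) = 1 - cdf \<nu> x"
proof -
  interpret real_distribution \<nu> by fact
  have "cdf \<nu> (- x) = measure (distr \<nu> borel uminus) {.. - x}"
    by (simp add: cdf_def sym)
  also have "\<dots> = measure \<nu> {x..}"
    by (subst measure_distr) (auto intro!: arg_cong[of _ _ "measure \<nu>"])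
  also have "\<dots> = measure \<nu> ({x} \<union> {x<..})"
    by (rule arg_cong[of _ _ "measure \<nu>"]) auto
  also have "\<dots> = measure \<nu> {x<..}"
    using assms(3) by (subst finite_measure_Union) auto
  also have "\<dots> = measure \<nu> (space \<nu> - {..x})"
    by (rule arg_cong[of _ _ "measure \<nu>"]) auto
  also have "\<dots> = 1 - cdf \<nu> x"
    by (subst prob_compl) (auto simp: cdf_def)
  finally show ?thesis .
qed

lemma measure_Icc_symmetric:
  assumes "real_distribution \<nu>" and sym: "distr \<nu> borel uminus = \<nu>"
    and atoms: "measure \<nu> {- x} = 0" "measure \<nu> {x} = 0" and "0 \<le> x"
  shows "measure \<nu> {- x..x} = 2 * cdf \<nu> x - 1"
proof -
  interpret real_distribution \<nu> by fact
  have "measure \<nu> {- x..x} = measure \<nu> ({- x} \<union> {- x<..x})"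
    using \<open>0 \<le> x\<close> by (intro arg_cong[of _ _ "measure \<nu>"]) auto
  also have "\<dots> = measure \<nu> {- x<..x}"
    using atoms by (subst finite_measure_Union) auto
  also have "\<dots> = cdf \<nu> x - cdf \<nu> (- x)"
  \<comment> \<open>\<open>cdf_diff_eq\<close> needs \<open>- x < x\<close>; for x = 0 the interval
    is empty and both sides vanish.\<close>
  proof (cases "x = 0")
    case False
    then show ?thesis using \<open>0 \<le> x\<close> by (intro cdf_diff_eq[symmetric]) auto
  qed auto
  also have "\<dots> = 2 * cdf \<nu> x - 1"
    using cdf_uminus_symmetric[OF assms(1,2) atoms(2)] by simp
  finally show ?thesis .
qed

lemma measure_density_lborel_singleton:
  fixes x :: real
  assumes "f \<in> borel_measurable lborel"
  shows "measure (density lborel f) {x} = 0"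
proof -
  have "emeasure (density lborel f) {x} = (\<integral>\<^sup>+y. f y * indicator {x} y \<partial>lborel)"
    using assms by (subst emeasure_density) auto
  also have "\<dots> = (\<integral>\<^sup>+y. 0 \<partial>(lborel :: real measure))"
    by (rule nn_integral_cong_AE) (use AE_lborel_singleton[of x] in \<open>eventually_elim, auto\<close>)
  finally show ?thesis
    by (simp add: measure_def)
qed

text \<open>The point x lies between -y and y, hence is a convex combination of two points at which
  the even function takes the same value; the weight t of y solves x = (2t - 1) y.\<close>

lemma even_convex_mono:
  fixes \<phi> :: "real \<Rightarrow> real"
  assumes conv: "convex_on UNIV \<phi>" and even: "\<And>x. \<phi> (- x) = \<phi> x" and le: "\<bar>x\<bar> \<le> \<bar>y\<bar>"
  shows "\<phi> x \<le> \<phi> y"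
proof (cases "y = 0")
  case False
  define t where "t = (x / y + 1) / 2"
  have "\<bar>x / y\<bar> \<le> 1"
    using False le by (simp add: abs_divide divide_simps)
  then have "- 1 \<le> x / y \<and> x / y \<le> 1"
    by linarith
  then have t: "0 \<le> t" "t \<le> 1"
    unfolding t_def by simp_all
  have "x = (1 - t) *\<^sub>R (- y) + t *\<^sub>R y"
    using False by (simp add: t_def field_simps)
  then have "\<phi> x \<le> (1 - t) * \<phi> (- y) + t * \<phi> y"
    using convex_onD[OF conv t, of "- y" y] by simp
  then show ?thesis
    by (simp add: even algebra_simps)
qed (use le in simp)

section \<open>The standard normal law and the constant \<open>C1\<close>\<close>

lemma std_normal_distribution_symmetric:
  "distr std_normal_distribution borel uminus = std_normal_distribution"
proof -
  interpret prob_space std_normal_distribution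
    by (rule prob_space_normal_density) simp
  have "distributed std_normal_distribution lborel (\<lambda>x. x) std_normal_density"
    by (auto simp: distributed_def distr_id2)
  from normal_density_affine[OF this, of "-1" 0]
  have "distributed std_normal_distribution lborel uminus std_normal_density"
    by simp
  then have "distr std_normal_distribution lborel uminus = std_normal_distribution"
    by (simp add: distributed_def)
  then show ?thesis
    by (metis distr_cong sets_lborel)
qed

lemma measure_std_normal_Icc:
  assumes "0 \<le> x"
  shows "measure std_normal_distribution {- x..x} = 2 * cdf std_normal_distribution x - 1"
  using assms
  by (intro measure_Icc_symmetric real_dist_normal_dist std_normal_distribution_symmetric
      measure_density_lborel_singleton) auto

lemma C1_eq_measure:
  "0 < c \<Longrightarrow> C1 c = measure std_normal_distribution {- (2 * sqrt c)..2 * sqrt c}"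
  by (simp add: C1_def measure_std_normal_Icc)

text \<open>On \<open>{- x..x}\<close> the normal density is at least its value at x, so the mass is
  at least the area of a rectangle with base 2x.\<close>

lemma C1_pos:
  assumes "0 < c"
  shows "0 < C1 c"
proof -
  interpret prob_space std_normal_distribution
    by (rule prob_space_normal_density) simp
  define x where "x = 2 * sqrt c"
  have x: "0 < x" using assms by (simp add: x_def)
  have "0 < ennreal (std_normal_density x * (2 * x))"
    using x by (simp add: normal_density_def)
  also have "\<dots> = (\<integral>\<^sup>+y. ennreal (std_normal_density x) * indicator {- x..x} y \<partial>lborel)"
    using x by (simp add: nn_integral_cmult_indicator ennreal_mult' normal_density_nonneg)
  also have "\<dots> \<le> (\<integral>\<^sup>+y. ennreal (std_normal_density y) * indicator {- x..x} y \<partial>lborel)"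
  proof (intro nn_integral_mono)
    fix y
    have "std_normal_density x \<le> std_normal_density y" if "y \<in> {- x..x}"
    proof -
      have "y\<^sup>2 \<le> x\<^sup>2"
        using that x by (simp add: abs_le_square_iff[symmetric] abs_le_iff)
      then show ?thesis
        by (simp add: std_normal_density_def divide_right_mono)
    qed
    then show "ennreal (std_normal_density x) * indicator {- x..x} y
      \<le> ennreal (std_normal_density y) * indicator {- x..x} y"
      by (simp add: indicator_def ennreal_leI)
  qed
  also have "\<dots> = emeasure std_normal_distribution {- x..x}"
    by (simp add: emeasure_density)
  finally show ?thesis
    using assms by (simp add: C1_eq_measure x_def[symmetric] emeasure_eq_measure)
qed

lemma C1_le_1: "0 < c \<Longrightarrow> C1 c \<le> 1"
proof -
  interpret prob_space std_normal_distribution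
    by (rule prob_space_normal_density) simp
  show "0 < c \<Longrightarrow> C1 c \<le> 1" by (simp add: C1_eq_measure)
qed

text \<open>Multiplication by \<open>sqrt c\<close> carries N(0, 1/c) to N(0, 1).\<close>

lemma measure_normal_Icc:
  assumes "0 < c"
  shows "measure (density lborel (normal_density 0 (1 / sqrt c))) {- t..t}
    = measure std_normal_distribution {- (t * sqrt c)..t * sqrt c}"
proof -
  let ?\<gamma> = "density lborel (normal_density 0 (1 / sqrt c))"
  interpret prob_space ?\<gamma>
    by (rule prob_space_normal_density) (use assms in simp)
  have "distributed ?\<gamma> lborel (\<lambda>x. x) (normal_density 0 (1 / sqrt c))"
    by (auto simp: distributed_def distr_id2)
  then have "distributed ?\<gamma> lborel (\<lambda>x. (x - 0) / (1 / sqrt c)) std_normal_density"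
    by (rule normal_standard_normal_convert[THEN iffD1, rotated]) (use assms in simp)
  then have "std_normal_distribution = distr ?\<gamma> lborel (\<lambda>x. x * sqrt c)"
    by (simp add: distributed_def)
  then have "measure std_normal_distribution {- (t * sqrt c)..t * sqrt c}
    = measure (distr ?\<gamma> lborel (\<lambda>x. x * sqrt c)) {- (t * sqrt c)..t * sqrt c}"
    by simp
  also have "\<dots> = measure ?\<gamma> ((\<lambda>x. x * sqrt c) -` {- (t * sqrt c)..t * sqrt c})"
    by (subst measure_distr) auto
  also have "(\<lambda>x. x * sqrt c) -` {- (t * sqrt c)..t * sqrt c} = {- t..t}"
    using assms mult_le_cancel_right_pos[of "sqrt c" "- t"] by auto
  finally show ?thesis by simp
qed

section \<open>The noise law and its concentration around 0\<close>

lemma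
  assumes "noise_law c \<nu>"
  shows noise_law_distribution: "real_distribution \<nu>"
    and noise_law_symmetric: "distr \<nu> borel uminus = \<nu>"
    and noise_law_atomless: "measure \<nu> {x} = 0"
proof -
  show sym: "distr \<nu> borel uminus = \<nu>"
    using assms by (simp add: noise_law_def)
  \<comment> \<open>The symmetry equation also fixes the \<sigma>-algebra, because a
    \<open>distr\<close> into \<open>borel\<close> has the Borel sets.\<close>
  then have "sets \<nu> = sets borel"
    by (metis sets_distr)
  moreover from this have "space \<nu> = UNIV"
    by (auto dest: sets_eq_imp_space_eq)
  ultimately show "real_distribution \<nu>"
    using assms by (auto simp: noise_law_def real_distribution_def real_distribution_axioms_def)
  obtain \<phi> :: "real \<Rightarrow> real" where \<phi>: "convex_on UNIV \<phi>"
    "\<nu> = density lborel (\<lambda>x. ennreal (exp (- \<phi> x) * exp (- (c * x\<^sup>2 / 2))))"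
    using assms by (auto simp: noise_law_def)
  have [measurable]: "\<phi> \<in> borel_measurable borel"
    using \<phi>(1) by (intro borel_measurable_continuous_onI convex_on_continuous) auto
  show "measure \<nu> {x} = 0"
    unfolding \<phi>(2) by (rule measure_density_lborel_singleton) measurable
qed

text \<open>The density of \<open>\<nu>\<close> relative to the normal law of variance \<open>1 / c\<close> is proportional to
  \<open>exp (- \<phi> x)\<close>, which decreases in \<open>\<bar>x\<bar>\<close>; so \<open>\<nu>\<close> is the more concentrated one.\<close>

lemma noise_law_concentration:
  assumes "0 < c" and \<nu>: "noise_law c \<nu>" and "0 \<le> t"
  shows "measure std_normal_distribution {- (t * sqrt c)..t * sqrt c} \<le> measure \<nu> {- t..t}"
proof -
  obtain \<phi> :: "real \<Rightarrow> real" where \<phi>: "convex_on UNIV \<phi>" "\<And>x. \<phi> (- x) = \<phi> x"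
    "\<nu> = density lborel (\<lambda>x. ennreal (exp (- \<phi> x) * exp (- (c * x\<^sup>2 / 2))))"
    using \<nu> by (auto simp: noise_law_def)
  have [measurable]: "\<phi> \<in> borel_measurable borel"
    using \<phi>(1) by (intro borel_measurable_continuous_onI convex_on_continuous) auto
  interpret N: prob_space \<nu>
    using \<nu> by (simp add: noise_law_def)
  define g where "g = normal_density 0 (1 / sqrt c)"
  let ?\<gamma> = "density lborel g"
  interpret G: prob_space ?\<gamma>
    unfolding g_def by (rule prob_space_normal_density) (use \<open>0 < c\<close> in simp)
  \<comment> \<open>\<open>q\<close> is the inverse of the normalizing factor of \<open>g\<close>,
    so \<open>q * exp (- \<phi> x)\<close> is the density of \<nu> relative to the normal law;
    \<open>k\<close> is its value at \<bar>x\<bar> = t.\<close>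
  define q where "q = sqrt (2 * pi / c)"
  define k where "k = exp (- \<phi> t) * q"
  have q: "0 < q" using \<open>0 < c\<close> by (simp add: q_def)
  have k: "0 \<le> k" using q by (simp add: k_def)
  have exp_g: "exp (- (c * x\<^sup>2 / 2)) = q * g x" for x
    using \<open>0 < c\<close> q
    by (simp add: g_def normal_density_def q_def power_divide mult.commute)
  have [measurable]: "g \<in> borel_measurable borel"
    by (simp add: g_def)
  have g0: "0 \<le> g x" for x
    by (simp add: g_def)
  have ratio: "exp (- \<phi> y) * (q * g z) \<le> exp (- \<phi> x) * (q * g z)" if "\<bar>x\<bar> \<le> \<bar>y\<bar>" for x y z
    using even_convex_mono[OF \<phi>(1,2) that] q g0[of z] by (intro mult_right_mono) auto
  have nu_em: "emeasure \<nu> A = (\<integral>\<^sup>+x. ennreal (exp (- \<phi> x) * (q * g x)) * indicator A x \<partial>lborel)"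
    if "A \<in> sets borel" for A
    unfolding \<phi>(3) using that by (subst emeasure_density) (auto simp: exp_g)
  have gamma_em: "ennreal k * emeasure ?\<gamma> A
      = (\<integral>\<^sup>+x. ennreal (exp (- \<phi> t) * (q * g x)) * indicator A x \<partial>lborel)"
    if "A \<in> sets borel" for A
    using that q k
    by (auto simp: emeasure_density nn_integral_cmult[symmetric] k_def ennreal_mult' ac_simps g0
        intro!: nn_integral_cong)
  have meas: "ennreal k * emeasure ?\<gamma> A = ennreal (k * measure ?\<gamma> A)" for A
    using k by (simp add: G.emeasure_eq_measure ennreal_mult')
  \<comment> \<open>Monotonicity of \<phi> in \<bar>x\<bar> makes the relative density at least
    \<open>k\<close> inside \<open>{- t..t}\<close> and, below, at most \<open>k\<close>
    outside.\<close>
  have "ennreal k * emeasure ?\<gamma> {- t..t} \<le> emeasure \<nu> {- t..t}"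
    by (subst nu_em, simp, subst gamma_em, simp, intro nn_integral_mono)
      (auto simp: indicator_def intro!: ennreal_leI ratio)
  then have inside: "k * measure ?\<gamma> {- t..t} \<le> measure \<nu> {- t..t}"
    by (simp add: meas N.emeasure_eq_measure)
  have "emeasure \<nu> (- {- t..t}) \<le> ennreal k * emeasure ?\<gamma> (- {- t..t})"
    using \<open>0 \<le> t\<close>
    by (subst nu_em, simp, subst gamma_em, simp, intro nn_integral_mono)
      (auto simp: indicator_def intro!: ennreal_leI ratio)
  then have "measure \<nu> (- {- t..t}) \<le> k * measure ?\<gamma> (- {- t..t})"
    using k by (simp add: meas N.emeasure_eq_measure)
  moreover have "space \<nu> = UNIV" "space ?\<gamma> = UNIV"
    by (auto simp: \<phi>(3))
  ultimately have "measure ?\<gamma> {- t..t} \<le> measure \<nu> {- t..t}"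
    by (intro prob_ge_of_density_ratio[OF N.prob_space_axioms G.prob_space_axioms _ _ inside])
      (auto simp: \<phi>(3) Compl_eq_Diff_UNIV)
  then show ?thesis
    using measure_normal_Icc[OF \<open>0 < c\<close>] by (simp add: g_def)
qed

text \<open>This is the concentration bound at t = 2, where \<open>t * sqrt c\<close> is the point
  that enters \<open>C1\<close>; symmetry rewrites the mass of \<open>{- 2..2}\<close> through the
  cdf.\<close>

lemma C1_le_cdf_noise:
  assumes "0 < c" "noise_law c \<nu>"
  shows "C1 c \<le> 2 * cdf \<nu> 2 - 1"
  using noise_law_concentration[OF assms, of 2] assms
  by (simp add: C1_eq_measure
      measure_Icc_symmetric noise_law_distribution noise_law_symmetric noise_law_atomless)

section \<open>The mean of a sign observation\<close>

text \<open>In the model this is also the expectation of \<open>Z i j\<close> when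
  \<open>\<theta> j\<close> equals t, since Laplace noise is centred.\<close>

definition mean_sign :: "real measure \<Rightarrow> real \<Rightarrow> real \<Rightarrow> real" where
  "mean_sign \<nu> \<sigma> t = (\<integral>x. sign1 (t + \<sigma> * x) \<partial>\<nu>)"

lemma sign1_measurable [measurable]: "sign1 \<in> borel_measurable borel"
  unfolding sign1_def[abs_def] by measurable

text \<open>As \<open>sign1\<close> is 1 at 0, it is twice the indicator of the closed half-line
  \<open>{- (t / \<sigma>)..}\<close> minus 1, and reflection turns this half-line into exactly the
  one that defines the cdf.\<close>

lemma mean_sign_eq_cdf:
  assumes "0 < \<sigma>" and \<nu>: "noise_law c \<nu>"
  shows "mean_sign \<nu> \<sigma> t = 2 * cdf \<nu> (t / \<sigma>) - 1"
proof -
  interpret real_distribution \<nu> using \<nu> by (rule noise_law_distribution)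
  have "mean_sign \<nu> \<sigma> t = (\<integral>x. 2 * indicator {- (t / \<sigma>)..} x - 1 \<partial>\<nu>)"
    unfolding mean_sign_def using \<open>0 < \<sigma>\<close>
    by (intro Bochner_Integration.integral_cong) (auto simp: sign1_def indicator_def field_simps)
  also have "\<dots> = 2 * measure \<nu> {- (t / \<sigma>)..} - 1"
    using prob_space by (subst Bochner_Integration.integral_diff) (auto simp: emeasure_eq_measure)
  also have "measure \<nu> {- (t / \<sigma>)..} = measure (distr \<nu> borel uminus) {..t / \<sigma>}"
    by (subst measure_distr) (auto intro!: arg_cong[of _ _ "measure \<nu>"])
  finally show ?thesis
    by (simp add: noise_law_symmetric[OF \<nu>] cdf_def)
qed

text \<open>By symmetry the cdf F of the noise satisfies F(0) = 1/2 and F(-2) = 1 - F(2). The two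
  bounds then follow from monotonicity, as t/\<sigma> lies beyond 2 or -2.\<close>

lemma
  assumes "0 < c" "0 < \<sigma>" and \<nu>: "noise_law c \<nu>"
  shows mean_sign_0: "mean_sign \<nu> \<sigma> 0 = 0"
    and mean_sign_ge: "2 * \<sigma> \<le> t \<Longrightarrow> C1 c \<le> mean_sign \<nu> \<sigma> t"
    and mean_sign_le: "t \<le> - (2 * \<sigma>) \<Longrightarrow> mean_sign \<nu> \<sigma> t \<le> - C1 c"
proof -
  interpret real_distribution \<nu> using \<nu> by (rule noise_law_distribution)
  note neg = cdf_uminus_symmetric[OF noise_law_distribution[OF \<nu>] noise_law_symmetric[OF \<nu>]
      noise_law_atomless[OF \<nu>]]
  show "mean_sign \<nu> \<sigma> 0 = 0"
    using neg[of 0] mean_sign_eq_cdf[OF assms(2,3), of 0] by simp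
  show "C1 c \<le> mean_sign \<nu> \<sigma> t" if "2 * \<sigma> \<le> t"
    using cdf_nondecreasing[of 2 "t / \<sigma>"] that \<open>0 < \<sigma>\<close> C1_le_cdf_noise[OF assms(1,3)]
      mean_sign_eq_cdf[OF assms(2,3), of t] by (simp add: le_divide_eq)
  show "mean_sign \<nu> \<sigma> t \<le> - C1 c" if "t \<le> - (2 * \<sigma>)"
    using cdf_nondecreasing[of "t / \<sigma>" "- 2"] that \<open>0 < \<sigma>\<close> C1_le_cdf_noise[OF assms(1,3)]
      mean_sign_eq_cdf[OF assms(2,3), of t] neg[of 2] by (simp add: divide_le_eq)
qed

section \<open>Exponential moments and Chernoff's bound\<close>

text \<open>With l = 1 - u or l = 1 + u this is the contribution of one half-line to the Laplace
  moment generating function at u.\<close>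

lemma nn_integral_exp_atLeast_0:
  fixes l :: real
  assumes "0 < l"
  shows "(\<integral>\<^sup>+x. ennreal (exp (- (l * x)) / 2) * indicator {0..} x \<partial>lborel) = ennreal (1 / (2 * l))"
proof -
  \<comment> \<open>The product is an antiderivative of the integrand; it vanishes at
    infinity.\<close>
  have "((\<lambda>x. exp (- (l * x)) * (- 1 / (2 * l))) \<longlongrightarrow> 0 * (- 1 / (2 * l))) at_top"
    by (intro tendsto_mult tendsto_const filterlim_compose[OF exp_at_bot]
        filterlim_uminus_at_bot_at_top[THEN filterlim_compose]
        filterlim_tendsto_pos_mult_at_top[OF tendsto_const assms] filterlim_ident)
  then have lim: "((\<lambda>x. exp (- (l * x)) * (- 1 / (2 * l))) \<longlongrightarrow> 0) at_top"
    by simp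
  have "(\<integral>\<^sup>+x. ennreal (exp (- (l * x)) / 2) * indicator {0..} x \<partial>lborel)
    = ennreal (0 - exp (- (l * 0)) * (- 1 / (2 * l)))"
    by (rule nn_integral_FTC_atLeast[OF _ _ _ lim])
      (use assms in \<open>auto intro!: derivative_eq_intros\<close>)
  then show ?thesis
    by simp
qed

lemma laplace_mgf_le:
  assumes "\<bar>u\<bar> \<le> 1 / 2"
  shows "(\<integral>\<^sup>+x. ennreal (laplace_density x) * ennreal (exp (u * x)) \<partial>lborel) \<le> ennreal (exp (2 * u\<^sup>2))"
proof -
  define f where "f v x = ennreal (exp (- ((1 - v) * x)) / 2) * indicator {0..} x" for v x :: real
  have [measurable]: "f v \<in> borel_measurable borel" for v
    unfolding f_def[abs_def] by measurable
  have f: "(\<integral>\<^sup>+x. f v x \<partial>lborel) = ennreal (1 / (2 * (1 - v)))" if "v < 1" for v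
    unfolding f_def by (rule nn_integral_exp_atLeast_0) (use that in simp)
  have u: "u < 1" "- u < 1" using assms by auto
  have u2: "u\<^sup>2 \<le> 1 / 4"
    using assms abs_le_square_iff[of u "1 / 2"] by (simp add: power2_eq_square)
  \<comment> \<open>Both half-lines are closed, so the origin is counted twice; hence an
    inequality.\<close>
  have "(\<integral>\<^sup>+x. ennreal (laplace_density x) * ennreal (exp (u * x)) \<partial>lborel)
    \<le> (\<integral>\<^sup>+x. f u x + f (- u) (- x) \<partial>lborel)"
  proof (rule nn_integral_mono)
    fix x :: real
    have "laplace_density x * exp (u * x) = exp (- ((1 - u) * x)) / 2" if "0 \<le> x"
      using that by (simp add: laplace_density_def algebra_simps flip: exp_add)
    moreover have "laplace_density x * exp (u * x) = exp (- ((1 - - u) * - x)) / 2" if "x < 0"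
      using that by (simp add: laplace_density_def algebra_simps flip: exp_add)
    ultimately show "ennreal (laplace_density x) * ennreal (exp (u * x)) \<le> f u x + f (- u) (- x)"
      by (cases "0 \<le> x") (auto simp: f_def laplace_density_def ennreal_mult'[symmetric])
  qed
  also have "\<dots> = (\<integral>\<^sup>+x. f u x \<partial>lborel) + (\<integral>\<^sup>+x. f (- u) (- x) \<partial>lborel)"
    by (rule nn_integral_add) auto
  also have "(\<integral>\<^sup>+x. f (- u) (- x) \<partial>lborel) = (\<integral>\<^sup>+x. f (- u) x \<partial>lborel)"
    using nn_integral_real_affine[of "f (- u)" "- 1" 0] by simp
  also have "(\<integral>\<^sup>+x. f u x \<partial>lborel) + (\<integral>\<^sup>+x. f (- u) x \<partial>lborel)
    = ennreal (1 / (2 * (1 - u)) + 1 / (2 * (1 - - u)))"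
    using u by (simp add: f ennreal_plus[symmetric] del: ennreal_plus)
  also have "1 / (2 * (1 - u)) + 1 / (2 * (1 - - u)) = 1 / (1 - u\<^sup>2)"
  proof -
    have "1 - u\<^sup>2 = (1 - u) * (1 + u)" by (simp add: power2_eq_square algebra_simps)
    then show ?thesis using u by (simp add: divide_simps) (simp add: algebra_simps)
  qed
  also have "1 / (1 - u\<^sup>2) \<le> exp (2 * u\<^sup>2)"
  proof -
    \<comment> \<open>With v = u^2 the product in the next claim is 1 + v - 2v^2, and v^2 \<le> v/4
      keeps it at least 1.\<close>
    have "u\<^sup>2 * u\<^sup>2 \<le> (1 / 4) * u\<^sup>2"
      using u2 by (rule mult_right_mono) simp
    then have "1 \<le> (1 + 2 * u\<^sup>2) * (1 - u\<^sup>2)"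
      using zero_le_power2[of u] unfolding ring_distribs by linarith
    then have "1 / (1 - u\<^sup>2) \<le> 1 + 2 * u\<^sup>2"
      using u2 by (simp add: divide_le_eq)
    also have "\<dots> \<le> exp (2 * u\<^sup>2)"
      by (rule exp_ge_add_one_self)
    finally show ?thesis .
  qed
  finally show ?thesis
    by (simp add: ennreal_leI)
qed

text \<open>Markov's inequality is applied to the exponential of the sum, which independence
  factors. The bounds \<open>b k\<close> may vary with k, as a mixture of signs and Laplace
  variables requires.\<close>

lemma (in prob_space) Chernoff_indep_sum:
  assumes "finite I" and indep: "indep_vars (\<lambda>_. borel) Y I" and "0 < l"
    and mgf: "\<And>k. k \<in> I \<Longrightarrow> (\<integral>\<^sup>+\<omega>. ennreal (exp (l * Y k \<omega>)) \<partial>M) \<le> ennreal (exp (b k))"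
  shows "prob {\<omega> \<in> space M. t \<le> (\<Sum>k\<in>I. Y k \<omega>)} \<le> exp ((\<Sum>k\<in>I. b k) - l * t)"
proof -
  have [measurable]: "random_variable borel (Y k)" if "k \<in> I" for k
    using indep that by (auto simp: indep_vars_def)
  have "emeasure M {\<omega> \<in> space M. t \<le> (\<Sum>k\<in>I. Y k \<omega>)}
    \<le> ennreal (exp (- l * t))
      * (\<integral>\<^sup>+\<omega>. ennreal (exp (l * (\<Sum>k\<in>I. Y k \<omega>))) * indicator (space M) \<omega> \<partial>M)"
    by (rule Chernoff_ineq_nn_integral_ge) (use \<open>0 < l\<close> in measurable)
  also have "(\<integral>\<^sup>+\<omega>. ennreal (exp (l * (\<Sum>k\<in>I. Y k \<omega>))) * indicator (space M) \<omega> \<partial>M)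
    = (\<integral>\<^sup>+\<omega>. (\<Prod>k\<in>I. ennreal (exp (l * Y k \<omega>))) \<partial>M)"
    using \<open>finite I\<close>
    by (intro nn_integral_cong) (simp add: sum_distrib_left exp_sum prod_ennreal)
  also have "\<dots> = (\<Prod>k\<in>I. \<integral>\<^sup>+\<omega>. ennreal (exp (l * Y k \<omega>)) \<partial>M)"
    by (intro indep_vars_nn_integral \<open>finite I\<close> indep_vars_compose2[OF indep]) auto
  also have "\<dots> \<le> (\<Prod>k\<in>I. ennreal (exp (b k)))"
    by (intro prod_mono_ennreal mgf)
  also have "\<dots> = ennreal (exp (\<Sum>k\<in>I. b k))"
    using \<open>finite I\<close> by (simp add: exp_sum prod_ennreal)
  finally have "emeasure M {\<omega> \<in> space M. t \<le> (\<Sum>k\<in>I. Y k \<omega>)}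
    \<le> ennreal (exp (- l * t) * exp (\<Sum>k\<in>I. b k))"
    by (simp add: ennreal_mult' mult_left_mono)
  then show ?thesis
    by (simp add: emeasure_eq_measure exp_diff exp_minus field_simps)
qed

text \<open>The variable ranges over an interval of length 2, so Hoeffding's lemma gives the
  exponent l^2 * 2^2 / 8. The sign r selects the tail.\<close>

lemma Hoeffding_centered_sign:
  assumes \<nu>: "noise_law c \<nu>" and "r \<in> {1, - 1}" and "0 < l"
  shows "(\<integral>\<^sup>+x. ennreal (exp (l * (r * (sign1 (t + \<sigma> * x) - mean_sign \<nu> \<sigma> t)))) \<partial>\<nu>)
    \<le> ennreal (exp (l\<^sup>2 / 2))"
proof -
  interpret real_distribution \<nu> using \<nu> by (rule noise_law_distribution)
  have [simp]: "sets \<nu> = sets borel" by (rule events_eq_borel)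
  interpret interval_bounded_random_variable \<nu> "\<lambda>x. r * sign1 (t + \<sigma> * x)" "- 1" 1
    by unfold_locales (use \<open>r \<in> {1, - 1}\<close> in \<open>auto simp: sign1_def\<close>)
  show ?thesis
    using Hoeffdings_lemma_nn_integral[OF \<open>0 < l\<close>]
    by (simp add: right_diff_distrib mean_sign_def)
qed

section \<open>Deviation of the sample mean in one coordinate\<close>

lemma sample_mean_tail:
  fixes \<sigma> :: real and \<theta> :: "nat \<Rightarrow> real"
  assumes \<nu>: "noise_law c \<nu>" and model: "sampling_model M \<nu> n d \<xi> W"
    and n: "1 \<le> n" and j: "j \<in> {1..d}" and \<alpha>: "0 < \<alpha>" "\<alpha> \<le> real d" and C: "0 < C" "C \<le> 1"
    and r: "r \<in> {1, - 1}"
  defines "Z \<equiv> privatize d \<alpha> (observation \<theta> \<sigma> \<xi>) W"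
  shows "measure M {\<omega> \<in> space M. C / 2 \<le> r * (sample_mean n Z j \<omega> - mean_sign \<nu> \<sigma> (\<theta> j))}
    \<le> exp (- (C\<^sup>2 / 2 ^ 8) * (real n * \<alpha>\<^sup>2 / (real d)\<^sup>2))"
proof -
  interpret prob_space M using model by (simp add: sampling_model_def)
  have d: "0 < real d" using j by auto
  define \<epsilon> where "\<epsilon> = \<alpha> / real d"
  have \<epsilon>: "0 < \<epsilon>" "\<epsilon> \<le> 1" using \<alpha> d by (auto simp: \<epsilon>_def)
  define m where "m = mean_sign \<nu> \<sigma> (\<theta> j)"
  define A where "A = {1..n} \<times> {j}"
  define X where "X = case_sum (\<lambda>(i, j). \<xi> i j) (\<lambda>(i, j). W i j)"
  \<comment> \<open>The n centred signs and the n scaled Laplace variables are treated as one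
    independent family of 2n summands, indexed by a disjoint sum.\<close>
  define f where "f = case_sum (\<lambda>(_ :: nat \<times> nat) x. r * (sign1 (\<theta> j + \<sigma> * x) - m))
    (\<lambda>(_ :: nat \<times> nat) x. r * (2 / \<epsilon> * x))"
  \<comment> \<open>This \<open>l\<close> minimizes 8 l^2 / \<epsilon>^2 - l C / 2, the exponent per
    observation without the sign term l^2 / 2. The Laplace variables are then evaluated at
    \<open>u\<close> = 2l/\<epsilon>, up to the sign r.\<close>
  define l where "l = C * \<epsilon>\<^sup>2 / 32"
  define u where "u = C * \<epsilon> / 16"
  define b where "b = case_sum (\<lambda>(_ :: nat \<times> nat). l\<^sup>2 / 2) (\<lambda>(_ :: nat \<times> nat). 2 * u\<^sup>2)"
  have l: "0 < l" using C \<epsilon> by (simp add: l_def)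
  have u: "\<bar>r * u\<bar> \<le> 1 / 2" "(r * u)\<^sup>2 = u\<^sup>2"
    using C \<epsilon> r mult_mono[of C 1 \<epsilon> 1] by (auto simp: u_def)
  have l_u: "l * (2 / \<epsilon>) = u" using \<epsilon> by (simp add: l_def u_def power2_eq_square)
  have fin: "finite A" by (simp add: A_def)
  have A: "A \<subseteq> {1..n} \<times> {1..d}" using j by (auto simp: A_def)
  have "indep_vars (\<lambda>_. borel) X (({1..n} \<times> {1..d}) <+> ({1..n} \<times> {1..d}))"
    using model by (simp add: sampling_model_def X_def)
  then have "indep_vars (\<lambda>_. borel) X (A <+> A)"
    by (rule indep_vars_subset) (use A in auto)
  then have indep: "indep_vars (\<lambda>_. borel) (\<lambda>k \<omega>. f k (X k \<omega>)) (A <+> A)"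
    by (rule indep_vars_compose2) (auto simp: f_def)
  have mgf: "(\<integral>\<^sup>+\<omega>. ennreal (exp (l * f k (X k \<omega>))) \<partial>M) \<le> ennreal (exp (b k))"
    if k: "k \<in> A <+> A" for k
    using k
  proof (rule PlusE)
    fix p assume p: "p \<in> A" "k = Inl p"
    obtain i where i: "p = (i, j)" "i \<in> {1..n}" using p(1) by (auto simp: A_def)
    have rv: "random_variable borel (\<xi> i j)" and law: "distr M borel (\<xi> i j) = \<nu>"
      using model i j by (auto simp: sampling_model_def)
    have "(\<integral>\<^sup>+\<omega>. ennreal (exp (l * f k (X k \<omega>))) \<partial>M)
      = (\<integral>\<^sup>+x. ennreal (exp (l * (r * (sign1 (\<theta> j + \<sigma> * x) - m)))) \<partial>distr M borel (\<xi> i j))"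
      by (subst nn_integral_distr[OF rv]) (auto simp: p i f_def X_def)
    then show ?thesis
      using Hoeffding_centered_sign[OF \<nu> r l, of "\<theta> j" \<sigma>] by (simp add: law p b_def m_def)
  next
    fix p assume p: "p \<in> A" "k = Inr p"
    obtain i where i: "p = (i, j)" "i \<in> {1..n}" using p(1) by (auto simp: A_def)
    have W: "distributed M lborel (W i j) (\<lambda>x. ennreal (laplace_density x))"
      using model i j by (auto simp: sampling_model_def)
    have "(\<integral>\<^sup>+\<omega>. ennreal (exp (l * f k (X k \<omega>))) \<partial>M) = (\<integral>\<^sup>+\<omega>. ennreal (exp (r * u * W i j \<omega>)) \<partial>M)"
      by (simp add: p i f_def X_def l_u[symmetric] ac_simps)
    also have "\<dots> = (\<integral>\<^sup>+x. ennreal (laplace_density x) * ennreal (exp (r * u * x)) \<partial>lborel)"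
      by (rule distributed_nn_integral[OF W, symmetric]) simp
    also have "\<dots> \<le> ennreal (exp (2 * (r * u)\<^sup>2))"
      by (rule laplace_mgf_le[OF u(1)])
    finally show ?thesis
      by (simp add: p b_def u(2))
  qed
  have A_sum: "(\<Sum>p\<in>A. h p) = (\<Sum>i=1..n. h (i, j))" for h :: "nat \<times> nat \<Rightarrow> real"
    using sum.cartesian_product[of "\<lambda>i j. h (i, j)" "{j}" "{1..n}"] by (simp add: A_def)
  have sum: "(\<Sum>k\<in>A <+> A. f k (X k \<omega>)) = real n * (r * (sample_mean n Z j \<omega> - m))" for \<omega>
  proof -
    have "(\<Sum>k\<in>A <+> A. f k (X k \<omega>)) = (\<Sum>i=1..n. r * (sign1 (\<theta> j + \<sigma> * \<xi> i j \<omega>) - m))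
        + (\<Sum>i=1..n. r * (2 / \<epsilon> * W i j \<omega>))"
      using fin by (simp add: sum.Plus f_def X_def A_sum comp_def)
    also have "\<dots> = (\<Sum>i=1..n. r * (Z i j \<omega> - m))"
      by (simp add: sum.distrib[symmetric] Z_def privatize_def observation_def \<epsilon>_def algebra_simps)
    also have "\<dots> = r * ((\<Sum>i=1..n. Z i j \<omega>) - real n * m)"
      by (simp add: sum_distrib_left[symmetric] sum_subtractf)
    also have "\<dots> = real n * (r * (sample_mean n Z j \<omega> - m))"
      using n by (simp add: sample_mean_def field_simps)
    finally show ?thesis .
  qed
  have sum_b: "(\<Sum>k\<in>A <+> A. b k) = real n * (l\<^sup>2 / 2 + 2 * u\<^sup>2)"
    using fin by (simp add: sum.Plus b_def comp_def A_def algebra_simps)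
  have "{\<omega> \<in> space M. C / 2 \<le> r * (sample_mean n Z j \<omega> - m)}
    = {\<omega> \<in> space M. real n * (C / 2) \<le> (\<Sum>k\<in>A <+> A. f k (X k \<omega>))}"
    using n
    by (simp only: sum mult_le_cancel_left_pos[of "real n"] of_nat_0_less_iff less_eq_Suc_le One_nat_def)
  then have "prob {\<omega> \<in> space M. C / 2 \<le> r * (sample_mean n Z j \<omega> - m)}
    \<le> exp ((\<Sum>k\<in>A <+> A. b k) - l * (real n * (C / 2)))"
    using Chernoff_indep_sum[OF _ indep l mgf, of "real n * (C / 2)"] fin by simp
  also have "(\<Sum>k\<in>A <+> A. b k) - l * (real n * (C / 2))
    = real n * (C\<^sup>2 * \<epsilon>\<^sup>2) * (\<epsilon>\<^sup>2 / 2048 - 1 / 128)"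
    unfolding sum_b by (simp add: l_def u_def power2_eq_square algebra_simps)
  \<comment> \<open>As \<epsilon> \<le> 1, the last factor is at most 1/2048 - 1/128 = -15/2048,
    which is below -1/256.\<close>
  also have "\<dots> \<le> real n * (C\<^sup>2 * \<epsilon>\<^sup>2) * (- 1 / 2 ^ 8)"
    using power_le_one[of \<epsilon> 2] \<epsilon> by (intro mult_left_mono) auto
  also have "\<dots> = - (C\<^sup>2 / 2 ^ 8) * (real n * \<alpha>\<^sup>2 / (real d)\<^sup>2)"
    by (simp add: \<epsilon>_def power_divide ac_simps)
  finally show ?thesis
    by (simp add: m_def)
qed

lemma sample_mean_measurable:
  assumes "sampling_model M \<nu> n d \<xi> W" "j \<in> {1..d}"
  shows "sample_mean n (privatize d \<alpha> (observation \<theta> \<sigma> \<xi>) W) j \<in> borel_measurable M"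
proof -
  have [measurable]: "\<xi> i j \<in> borel_measurable M" "W i j \<in> borel_measurable M"
    if "i \<in> {1..n}" for i
    using assms that distributed_measurable[of M lborel "W i j" "\<lambda>x. ennreal (laplace_density x)"]
    by (auto simp: sampling_model_def)
  show ?thesis
    unfolding sample_mean_def[abs_def] privatize_def observation_def by measurable
qed

section \<open>Risk bounds for both selectors\<close>

text \<open>This is the part common to both selectors: an error in a coordinate forces an upper or a
  lower deviation, and the two tails account for the factor 2.\<close>

lemma expected_hamming_loss_le:
  fixes \<sigma> :: real and \<theta> :: "nat \<Rightarrow> real"
  assumes \<nu>: "noise_law c \<nu>" and model: "sampling_model M \<nu> n d \<xi> W"
    and n: "1 \<le> n" and \<alpha>: "0 < \<alpha>" "\<alpha> \<le> real d" and c: "0 < c"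
  defines "Z \<equiv> privatize d \<alpha> (observation \<theta> \<sigma> \<xi>) W"
  assumes err: "\<And>\<omega> j. j \<in> {1..d} \<Longrightarrow> est \<omega> j \<noteq> v j
    \<Longrightarrow> C1 c / 2 \<le> \<bar>sample_mean n Z j \<omega> - mean_sign \<nu> \<sigma> (\<theta> j)\<bar>"
  shows "(\<integral>\<omega>. hamming_loss d (est \<omega>) v \<partial>M)
    \<le> 2 * real d * exp (- ((C1 c)\<^sup>2 / 2 ^ 8) * (real n * \<alpha>\<^sup>2 / (real d)\<^sup>2))"
proof -
  interpret prob_space M using model by (simp add: sampling_model_def)
  define p where "p = exp (- ((C1 c)\<^sup>2 / 2 ^ 8) * (real n * \<alpha>\<^sup>2 / (real d)\<^sup>2))"
  define D where "D j \<omega> = sample_mean n Z j \<omega> - mean_sign \<nu> \<sigma> (\<theta> j)" for j \<omega>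
  define E where "E r j = {\<omega> \<in> space M. C1 c / 2 \<le> r * D j \<omega>}" for r :: real and j
  have [measurable]: "D j \<in> borel_measurable M" if "j \<in> {1..d}" for j
    unfolding D_def[abs_def] Z_def using sample_mean_measurable[OF model that] by measurable
  have E: "E r j \<in> sets M" if "j \<in> {1..d}" for r j
    unfolding E_def using that by measurable
  have "(\<integral>\<omega>. hamming_loss d (est \<omega>) v \<partial>M)
    \<le> (\<integral>\<omega>. (\<Sum>j=1..d. indicator (E 1 j) \<omega> + indicator (E (- 1) j) \<omega>) \<partial>M)"
  \<comment> \<open>Integrability is asked only of the dominating sum: a Bochner integral that does
    not exist is 0, and the sum is nonnegative. So \<open>est\<close> can stay arbitrary.\<close>
  proof (rule integral_mono')
    show "integrable M (\<lambda>\<omega>. \<Sum>j=1..d. indicator (E 1 j) \<omega> + indicator (E (- 1) j) \<omega> :: real)"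
      using E by (auto simp: emeasure_eq_measure)
    fix \<omega> assume "\<omega> \<in> space M"
    then show "hamming_loss d (est \<omega>) v
      \<le> (\<Sum>j=1..d. indicator (E 1 j) \<omega> + indicator (E (- 1) j) \<omega>)"
      unfolding hamming_loss_def using err[of _ \<omega>]
      by (intro sum_mono) (fastforce simp: E_def D_def indicator_def abs_if split: if_splits)
    show "0 \<le> (\<Sum>j=1..d. indicator (E 1 j) \<omega> + indicator (E (- 1) j) \<omega> :: real)"
      by (intro sum_nonneg) simp
  qed
  also have "\<dots> = (\<Sum>j=1..d. prob (E 1 j) + prob (E (- 1) j))"
    using E
    by (subst Bochner_Integration.integral_sum) (auto simp: emeasure_eq_measure intro!: sum.cong)
  also have "\<dots> \<le> (\<Sum>j=1..d. p + p)"
    unfolding E_def D_def p_def Z_def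
    by (intro sum_mono add_mono sample_mean_tail[OF \<nu> model n _ \<alpha>] C1_pos C1_le_1 c) auto
  finally show ?thesis
    by (simp add: p_def)
qed

text \<open>The threshold lies midway between the mean 0 of a null coordinate and the lower bound
  \<open>C1 c\<close> for the mean of an active one, so either kind of error costs a deviation of
  \<open>C1 c / 2\<close>.\<close>

lemma risk_plus_le:
  assumes \<nu>: "noise_law c \<nu>" and model: "sampling_model M \<nu> n d \<xi> W"
    and n: "1 \<le> n" and \<alpha>: "0 < \<alpha>" "\<alpha> \<le> real d" and c: "0 < c" and "0 < \<sigma>" "2 * \<sigma> \<le> a"
    and \<theta>: "\<theta> \<in> Theta_plus d s a"
  shows "risk_plus M c \<sigma> n d \<alpha> \<xi> W \<theta>
    \<le> 2 * real d * exp (- ((C1 c)\<^sup>2 / 2 ^ 8) * (real n * \<alpha>\<^sup>2 / (real d)\<^sup>2))"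
  unfolding risk_plus_def Let_def
proof (rule expected_hamming_loss_le[OF \<nu> model n \<alpha> c])
  fix \<omega> j
  let ?x = "sample_mean n (privatize d \<alpha> (observation \<theta> \<sigma> \<xi>) W) j \<omega>"
  assume j: "j \<in> {1..d}"
    and err: "eta_hat_plus (C1 c / 2) n (privatize d \<alpha> (observation \<theta> \<sigma> \<xi>) W) \<omega> j \<noteq> eta \<theta> j"
  have "\<theta> j = 0 \<or> 2 * \<sigma> \<le> \<theta> j"
    using \<theta> j \<open>2 * \<sigma> \<le> a\<close> by (fastforce simp: Theta_plus_def)
  then show "C1 c / 2 \<le> \<bar>?x - mean_sign \<nu> \<sigma> (\<theta> j)\<bar>"
  proof
    assume "\<theta> j = 0"
    then show ?thesis
      using err mean_sign_0[OF c \<open>0 < \<sigma>\<close> \<nu>]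
      by (auto simp: eta_hat_plus_def eta_def of_bool_def split: if_splits)
  next
    assume ge: "2 * \<sigma> \<le> \<theta> j"
    then have "?x < C1 c / 2"
      using err \<open>0 < \<sigma>\<close> by (auto simp: eta_hat_plus_def eta_def of_bool_def split: if_splits)
    then show ?thesis
      using mean_sign_ge[OF c \<open>0 < \<sigma>\<close> \<nu> ge] by linarith
  qed
qed

text \<open>An active coordinate of either sign has a mean of absolute value at least
  \<open>C1 c\<close>, and the triangle inequality replaces the one-sided comparison.\<close>

lemma risk_le:
  assumes \<nu>: "noise_law c \<nu>" and model: "sampling_model M \<nu> n d \<xi> W"
    and n: "1 \<le> n" and \<alpha>: "0 < \<alpha>" "\<alpha> \<le> real d" and c: "0 < c" and "0 < \<sigma>" "2 * \<sigma> \<le> a"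
    and \<theta>: "\<theta> \<in> Theta d s a"
  shows "risk M c \<sigma> n d \<alpha> \<xi> W \<theta>
    \<le> 2 * real d * exp (- ((C1 c)\<^sup>2 / 2 ^ 8) * (real n * \<alpha>\<^sup>2 / (real d)\<^sup>2))"
  unfolding risk_def Let_def
proof (rule expected_hamming_loss_le[OF \<nu> model n \<alpha> c])
  fix \<omega> j
  let ?x = "sample_mean n (privatize d \<alpha> (observation \<theta> \<sigma> \<xi>) W) j \<omega>"
  assume j: "j \<in> {1..d}"
    and err: "eta_hat (C1 c / 2) n (privatize d \<alpha> (observation \<theta> \<sigma> \<xi>) W) \<omega> j \<noteq> eta \<theta> j"
  have "\<theta> j = 0 \<or> 2 * \<sigma> \<le> \<bar>\<theta> j\<bar>"
    using \<theta> j \<open>2 * \<sigma> \<le> a\<close> by (fastforce simp: Theta_def)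
  then show "C1 c / 2 \<le> \<bar>?x - mean_sign \<nu> \<sigma> (\<theta> j)\<bar>"
  proof
    assume "\<theta> j = 0"
    then show ?thesis
      using err mean_sign_0[OF c \<open>0 < \<sigma>\<close> \<nu>]
      by (auto simp: eta_hat_def eta_def of_bool_def split: if_splits)
  next
    assume ge: "2 * \<sigma> \<le> \<bar>\<theta> j\<bar>"
    then have "\<bar>?x\<bar> < C1 c / 2"
      using err \<open>0 < \<sigma>\<close> by (auto simp: eta_hat_def eta_def of_bool_def split: if_splits)
    moreover have "C1 c \<le> \<bar>mean_sign \<nu> \<sigma> (\<theta> j)\<bar>"
      using ge mean_sign_ge[OF c \<open>0 < \<sigma>\<close> \<nu>, of "\<theta> j"] mean_sign_le[OF c \<open>0 < \<sigma>\<close> \<nu>, of "\<theta> j"]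
      by (cases "0 \<le> \<theta> j") (auto simp: abs_if split: if_splits)
    ultimately show ?thesis
      by linarith
  qed
qed

section \<open>Suprema over the parameter sets and limits\<close>

lemma hamming_loss_nonneg: "0 \<le> hamming_loss d u v"
  by (simp add: hamming_loss_def sum_nonneg)

lemma risk_nonneg:
  "0 \<le> risk_plus M c \<sigma> n d \<alpha> \<xi> W \<theta>" "0 \<le> risk M c \<sigma> n d \<alpha> \<xi> W \<theta>"
  by (simp_all add: risk_plus_def risk_def Let_def hamming_loss_nonneg)

lemma zero_in_Theta:
  "(\<lambda>j\<in>{1..d}. 0) \<in> Theta_plus d s a" "(\<lambda>j\<in>{1..d}. 0) \<in> Theta d s a"
  by (auto simp: Theta_plus_def Theta_def intro!: exI[of _ "{}"])

text \<open>A real supremum needs a nonempty bounded set: the eventual bound \<open>b d\<close>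
  gives boundedness, and a single nonnegative value gives the lower side of the sandwich.\<close>

lemma tendsto_SUP_zero:
  fixes f :: "nat \<Rightarrow> 'a \<Rightarrow> real"
  assumes "\<And>d. S d \<noteq> {}" and "\<And>d x. 0 \<le> f d x"
    and le: "\<forall>\<^sub>F d in sequentially. \<forall>x\<in>S d. f d x \<le> b d" and "b \<longlonglongrightarrow> 0"
  shows "(\<lambda>d. SUP x\<in>S d. f d x) \<longlonglongrightarrow> 0"
proof (rule tendsto_sandwich[OF _ _ tendsto_const \<open>b \<longlonglongrightarrow> 0\<close>])
  show "\<forall>\<^sub>F d in sequentially. 0 \<le> (SUP x\<in>S d. f d x)"
    using le
  proof eventually_elim
    case (elim d)
    obtain x where "x \<in> S d" using assms(1) by blast
    then show ?case
      using elim assms(2) by (intro cSUP_upper2[where x = x]) (auto intro: bdd_aboveI2)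
  qed
  show "\<forall>\<^sub>F d in sequentially. (SUP x\<in>S d. f d x) \<le> b d"
    using le by eventually_elim (use assms(1) in \<open>auto intro!: cSUP_least\<close>)
qed

text \<open>The exponential decays at rate 2K in T, while d/k eventually grows at most at rate K;
  half of the decay survives.\<close>

lemma ratio_mult_exp_tendsto_0:
  fixes T :: "nat \<Rightarrow> real" and k :: "nat \<Rightarrow> nat"
  assumes T: "filterlim T at_top sequentially" and "0 < K" and k: "\<And>d. 1 \<le> d \<Longrightarrow> 1 \<le> k d"
    and limsup: "limsup (\<lambda>d. ereal (ln (real d / real (k d)) / T d)) < ereal K"
  shows "(\<lambda>d. 1 / real (k d) * (2 * real d * exp (- (2 * K) * T d))) \<longlonglongrightarrow> 0"
proof (rule tendsto_sandwich[OF _ _ tendsto_const])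
  show "\<forall>\<^sub>F d in sequentially. 0 \<le> 1 / real (k d) * (2 * real d * exp (- (2 * K) * T d))"
    by simp
  have "filterlim (\<lambda>d. - (K * T d)) at_bot sequentially"
    using filterlim_tendsto_pos_mult_at_top[OF tendsto_const \<open>0 < K\<close> T]
    by (simp add: filterlim_uminus_at_bot)
  then have "(\<lambda>d. exp (- (K * T d))) \<longlonglongrightarrow> 0"
    by (rule filterlim_compose[OF exp_at_bot])
  then show "(\<lambda>d. 2 * exp (- (K * T d))) \<longlonglongrightarrow> 0"
    by (rule tendsto_mult_right_zero)
  have "\<forall>\<^sub>F d in sequentially. ln (real d / real (k d)) / T d < K"
    using Limsup_lessD[OF limsup] by simp
  moreover have "\<forall>\<^sub>F d in sequentially. 0 < T d"
    using T by (simp add: filterlim_at_top_dense)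
  ultimately show "\<forall>\<^sub>F d in sequentially. 1 / real (k d) * (2 * real d * exp (- (2 * K) * T d))
      \<le> 2 * exp (- (K * T d))"
    using eventually_ge_at_top[of 1]
  proof eventually_elim
    case (elim d)
    \<comment> \<open>\<open>0 < T d\<close> permits clearing the denominator, and
      \<open>1 \<le> d\<close> makes the ratio positive, so that \<open>ln\<close> can be
      inverted.\<close>
    then have "ln (real d / real (k d)) < K * T d" and pos: "0 < real d / real (k d)"
      using k[of d] by (simp_all add: divide_less_eq)
    then have "real d / real (k d) \<le> exp (K * T d)"
      by (metis exp_less_mono exp_ln less_imp_le)
    then have "real d / real (k d) * (2 * exp (- (2 * K) * T d))
      \<le> exp (K * T d) * (2 * exp (- (2 * K) * T d))"
      by (rule mult_right_mono) simp
    also have "\<dots> = 2 * exp (- (K * T d))"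
      by (simp add: exp_add[symmetric])
    finally show ?case
      by (simp add: ac_simps)
  qed
qed

theorem corollary2p5:
  fixes \<sigma> c :: real
    and \<nu> :: "real measure"
    and n s :: "nat \<Rightarrow> nat"
    and \<alpha> a :: "nat \<Rightarrow> real"
    and M :: "nat \<Rightarrow> 'w measure"
    and \<xi> W :: "nat \<Rightarrow> nat \<Rightarrow> nat \<Rightarrow> 'w \<Rightarrow> real"
  assumes "\<sigma> > 0" and "c > 0"
    and "noise_law c \<nu>"
    and "\<And>d. d \<ge> 1 \<Longrightarrow> sampling_model (M d) \<nu> (n d) d (\<xi> d) (W d)"
    and "\<And>d. d \<ge> 1 \<Longrightarrow> n d \<ge> 1"
    and "\<And>d. d \<ge> 1 \<Longrightarrow> \<alpha> d > 0"
    and "\<And>d. d \<ge> 1 \<Longrightarrow> 1 \<le> s d \<and> s d \<le> d"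
    and "\<And>d. d \<ge> 1 \<Longrightarrow> a d \<ge> 2 * \<sigma>"
    and "(\<lambda>d. \<alpha> d / real d) \<longlonglongrightarrow> 0"
    and "filterlim (\<lambda>d. real (n d) * (\<alpha> d)\<^sup>2 / (real d)\<^sup>2) at_top sequentially"
    and "limsup (\<lambda>d. ereal (ln (real d / real (s d)) / (real (n d) * (\<alpha> d)\<^sup>2 / (real d)\<^sup>2)))
           < ereal ((C1 c)\<^sup>2 / 2 ^ 9)"
  shows "C1 c > 0
    \<and> (\<lambda>d. SUP \<theta>\<in>Theta_plus d (s d) (a d).
           1 / real (s d) * risk_plus (M d) c \<sigma> (n d) d (\<alpha> d) (\<xi> d) (W d) \<theta>) \<longlonglongrightarrow> 0
    \<and> (\<lambda>d. SUP \<theta>\<in>Theta d (s d) (a d).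
           1 / real (s d) * risk (M d) c \<sigma> (n d) d (\<alpha> d) (\<xi> d) (W d) \<theta>) \<longlonglongrightarrow> 0
    \<and> (limsup (\<lambda>d. ereal (ln (real d) / (real (n d) * (\<alpha> d)\<^sup>2 / (real d)\<^sup>2)))
           < ereal ((C1 c)\<^sup>2 / 2 ^ 9) \<longrightarrow>
         (\<lambda>d. SUP \<theta>\<in>Theta_plus d (s d) (a d).
            risk_plus (M d) c \<sigma> (n d) d (\<alpha> d) (\<xi> d) (W d) \<theta>) \<longlonglongrightarrow> 0
       \<and> (\<lambda>d. SUP \<theta>\<in>Theta d (s d) (a d).
            risk (M d) c \<sigma> (n d) d (\<alpha> d) (\<xi> d) (W d) \<theta>) \<longlonglongrightarrow> 0)"
proof -
  define T where "T d = real (n d) * (\<alpha> d)\<^sup>2 / (real d)\<^sup>2" for d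
  define B where "B d = 2 * real d * exp (- ((C1 c)\<^sup>2 / 2 ^ 8) * T d)" for d
  have C: "0 < C1 c" using \<open>c > 0\<close> by (rule C1_pos)
  have T: "filterlim T at_top sequentially"
    using assms(10) by (simp add: T_def[abs_def])
  \<comment> \<open>The limit 0 enters through \<alpha> \<le> d, the condition of the tail
    bound.\<close>
  have "\<forall>\<^sub>F d in sequentially. \<alpha> d / real d < 1"
    using assms(9) by (rule order_tendstoD) simp
  then have ev: "\<forall>\<^sub>F d in sequentially. 1 \<le> d \<and> \<alpha> d \<le> real d"
    using eventually_ge_at_top[of 1] by eventually_elim (auto simp: divide_less_eq)
  have plus: "\<forall>\<^sub>F d in sequentially. \<forall>\<theta>\<in>Theta_plus d (s d) (a d).
      risk_plus (M d) c \<sigma> (n d) d (\<alpha> d) (\<xi> d) (W d) \<theta> \<le> B d"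
    using ev
  proof eventually_elim
    case (elim d)
    then show ?case
      unfolding B_def T_def
      by (intro ballI risk_plus_le[OF assms(3-6) _ assms(2,1,8)]) auto
  qed
  have abs: "\<forall>\<^sub>F d in sequentially. \<forall>\<theta>\<in>Theta d (s d) (a d).
      risk (M d) c \<sigma> (n d) d (\<alpha> d) (\<xi> d) (W d) \<theta> \<le> B d"
    using ev
  proof eventually_elim
    case (elim d)
    then show ?case
      unfolding B_def T_def
      by (intro ballI risk_le[OF assms(3-6) _ assms(2,1,8)]) auto
  qed
  \<comment> \<open>Here K is \<open>(C1 c)\<^sup>2 / 2 ^ 9\<close>, half the decay rate in
    \<open>B\<close>. Taking k = s gives the normalized claims, k = 1 the unnormalized ones.\<close>
  have B: "(\<lambda>d. 1 / real (k d) * B d) \<longlonglongrightarrow> 0"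
    if "\<And>d. 1 \<le> d \<Longrightarrow> 1 \<le> k d"
      "limsup (\<lambda>d. ereal (ln (real d / real (k d)) / T d)) < ereal ((C1 c)\<^sup>2 / 2 ^ 9)" for k
    using ratio_mult_exp_tendsto_0[OF T _ that(1) that(2)] C by (simp add: B_def)
  have S: "Theta_plus d (s d) (a d) \<noteq> {}" "Theta d (s d) (a d) \<noteq> {}" for d
    using zero_in_Theta by blast+
  have Bs: "(\<lambda>d. 1 / real (s d) * B d) \<longlonglongrightarrow> 0"
    using assms(7,11) by (intro B) (auto simp: T_def)
  have "(\<lambda>d. SUP \<theta>\<in>Theta_plus d (s d) (a d).
      1 / real (s d) * risk_plus (M d) c \<sigma> (n d) d (\<alpha> d) (\<xi> d) (W d) \<theta>) \<longlonglongrightarrow> 0"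
    by (rule tendsto_SUP_zero[OF S(1) _ _ Bs])
      (use plus in \<open>auto simp: risk_nonneg elim!: eventually_mono intro!: divide_right_mono\<close>)
  moreover have "(\<lambda>d. SUP \<theta>\<in>Theta d (s d) (a d).
      1 / real (s d) * risk (M d) c \<sigma> (n d) d (\<alpha> d) (\<xi> d) (W d) \<theta>) \<longlonglongrightarrow> 0"
    by (rule tendsto_SUP_zero[OF S(2) _ _ Bs])
      (use abs in \<open>auto simp: risk_nonneg elim!: eventually_mono intro!: divide_right_mono\<close>)
  moreover have "(\<lambda>d. SUP \<theta>\<in>Theta_plus d (s d) (a d).
        risk_plus (M d) c \<sigma> (n d) d (\<alpha> d) (\<xi> d) (W d) \<theta>) \<longlonglongrightarrow> 0
      \<and> (\<lambda>d. SUP \<theta>\<in>Theta d (s d) (a d).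
        risk (M d) c \<sigma> (n d) d (\<alpha> d) (\<xi> d) (W d) \<theta>) \<longlonglongrightarrow> 0"
    if "limsup (\<lambda>d. ereal (ln (real d) / (real (n d) * (\<alpha> d)\<^sup>2 / (real d)\<^sup>2)))
      < ereal ((C1 c)\<^sup>2 / 2 ^ 9)"
  proof -
    have "B \<longlonglongrightarrow> 0"
      using B[of "\<lambda>_. 1"] that by (simp add: T_def)
    then show ?thesis
      using tendsto_SUP_zero[OF S(1) risk_nonneg(1) plus] tendsto_SUP_zero[OF S(2) risk_nonneg(2) abs]
      by blast
  qed
  ultimately show ?thesis
    using C by blast
qed

end
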